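(* Let $f\colon\mathbb{R}^n\to[-\infty,+\infty]$ be a proper nearly convex function and let $D\subset\mathbb{R}^n$ be a nonempty nearly convex set such that $(\mathrm{ri}\,D)\cap\mathrm{ri}(\mathrm{dom}\,f)\neq\emptyset$. Let $\mathcal S$ be the solution set of $\min\{f(x)\mid x\in D\}$ and $\mathcal S_1$ the solution set of $\min\{\bar f(x)\mid x\in\bar D\}$. Then $\mathcal S\subset\mathcal S_1$.
   Context: A set $\Omega\subset\mathbb{R}^n$ is nearly convex if there is a convex set $C\subset\mathbb{R}^n$ with $C\subset\Omega\subset\bar C$, where the bar on a set denotes topological closure. For an arbitrary set $\Omega$, $\mathrm{ri}\,\Omega$ is the interior of $\Omega$ relative to its affine hull. For $f\colon\mathbb{R}^n\to[-\infty,+\infty]$: $\mathrm{dom}\,f=\{x\mid f(x)<+\infty\}$, $\mathrm{epi}\,f=\{(x,\lambda)\in\mathbb{R}^n\times\mathbb{R}\mid f(x)\le\lambda\}$; $f$ is proper if $\mathrm{dom}\,f\ne\emptyset$ and $f(x)>-\infty$ for all $x$; $f$ is nearly convex if $\mathrm{epi}\,f$ is a nearly convex set. The function $\bar f\colon\mathbb{R}^n\to[-\infty,+\infty]$ is defined by $\bar f(x)=\inf\{\alpha\in\mathbb{R}\mid (x,\alpha)\in\overline{\mathrm{epi}\,f}\}$, with $\inf\emptyset=+\infty$. A solution of a problem $\min\{h(x)\mid x\in E\}$ is a point $\bar x\in E$ with $h(\bar x)\le h(x)$ for all $x\in E$. *)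

theory Defs
  imports "HOL-Analysis.Analysis"
begin

definition nearly_convex :: "'a::real_normed_vector set \<Rightarrow> bool" where
  "nearly_convex S \<longleftrightarrow> (\<exists>C. convex C \<and> C \<subseteq> S \<and> S \<subseteq> closure C)"

definition edom :: "('a \<Rightarrow> ereal) \<Rightarrow> 'a set" where
  "edom f = {x. f x < \<infinity>}"

(* The library's epigraph is for real-valued functions only. *)
definition epi :: "('a \<Rightarrow> ereal) \<Rightarrow> ('a \<times> real) set" where
  "epi f = {(x, r). f x \<le> ereal r}"

definition proper_fun :: "('a \<Rightarrow> ereal) \<Rightarrow> bool" where
  "proper_fun f \<longleftrightarrow> edom f \<noteq> {} \<and> (\<forall>x. f x > -\<infinity>)"

definition nearly_convex_fun :: "('a::real_normed_vector \<Rightarrow> ereal) \<Rightarrow> bool" where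
  "nearly_convex_fun f \<longleftrightarrow> nearly_convex (epi f)"

(* The infimum is taken in ereal, so Inf {} is plus infinity and the value is
   minus infinity when the set of reals is not bounded below. *)
definition closure_fun :: "('a::topological_space \<Rightarrow> ereal) \<Rightarrow> 'a \<Rightarrow> ereal" where
  "closure_fun f x = Inf (ereal ` {r. (x, r) \<in> closure (epi f)})"

definition solution_set :: "('a \<Rightarrow> ereal) \<Rightarrow> 'a set \<Rightarrow> 'a set" where
  "solution_set h E = {x \<in> E. \<forall>y\<in>E. h x \<le> h y}"

end

(* A point y of closure D with closure_fun f y < f x gives (y, r) in the closure of the
   epigraph with r < f x. Moving y slightly towards a common relative interior point z of
   D and dom f, and (y, r) towards a point (z, s) in the relative interior of the epigraph,
   one lands in D and in the epigraph simultaneously, still below the level f x, which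
   contradicts the minimality of x on D. *)
theory Submission
  imports Defs
begin

text \<open>\<open>C\<close> and \<open>closure C\<close> share their affine hull and,
  \<open>C\<close> being convex, their relative interior. With equal hulls
  \<open>rel_interior\<close> is monotone, so \<open>S\<close> is squeezed between them.\<close>

lemma rel_interior_between_convex_closure:
  fixes C S :: "'a::euclidean_space set"
  assumes "convex C" "C \<subseteq> S" "S \<subseteq> closure C"
  shows "rel_interior S = rel_interior C"
proof -
  have "affine hull S \<subseteq> affine hull C"
    using hull_mono[OF assms(3), of affine] by simp
  then have aff: "affine hull S = affine hull C"
    using hull_mono[OF assms(2), of affine] by blast
  have "rel_interior S \<subseteq> rel_interior (closure C)"
    using assms(3) aff by (intro subset_rel_interior) auto
  moreover have "rel_interior C \<subseteq> rel_interior S"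
    using assms(2) aff by (intro subset_rel_interior) auto
  ultimately show ?thesis
    using convex_rel_interior_closure[OF assms(1)] by blast
qed

text \<open>The line segment principle, transferred from the convex set \<open>C\<close>, which has
  the same closure and relative interior as \<open>S\<close>.\<close>

lemma nearly_convex_segment_in_rel_interior:
  fixes S :: "'a::euclidean_space set"
  assumes "nearly_convex S" "z \<in> rel_interior S" "y \<in> closure S" "0 < t" "t \<le> 1"
  shows "y - t *\<^sub>R (y - z) \<in> rel_interior S"
proof -
  obtain C where C: "convex C" "C \<subseteq> S" "S \<subseteq> closure C"
    using assms(1) by (auto simp: nearly_convex_def)
  have "y \<in> closure C"
    using closure_mono[OF C(3)] assms(3) by auto
  then show ?thesis
    using rel_interior_closure_convex_shrink[OF C(1), of z y t] assms
      rel_interior_between_convex_closure[OF C] by simp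
qed

text \<open>By continuity of \<open>h\<close>, the set \<open>h\<close>
  S\<open>lies between the convex set\<close>h \<open>C\<close> and its closure, which reduces the
  claim to the convex case.\<close>

lemma nearly_convex_linear_image_rel_interior:
  fixes h :: "'a::euclidean_space \<Rightarrow> 'b::euclidean_space"
  assumes "linear h" "nearly_convex S"
  shows "rel_interior (h ` S) = h ` rel_interior S"
proof -
  obtain C where C: "convex C" "C \<subseteq> S" "S \<subseteq> closure C"
    using assms(2) by (auto simp: nearly_convex_def)
  have "h ` S \<subseteq> closure (h ` C)"
    using closure_linear_image_subset[OF assms(1), of C] C(3) by blast
  then have "rel_interior (h ` S) = rel_interior (h ` C)"
    using C assms(1) by (intro rel_interior_between_convex_closure convex_linear_image) auto
  then show ?thesis
    using rel_interior_convex_linear_image[OF assms(1) C(1)]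
      rel_interior_between_convex_closure[OF C] by simp
qed

text \<open>Presents the domain as a linear image, so that its relative interior points lift to the
  epigraph.\<close>

lemma edom_eq_fst_epi: "edom f = fst ` epi f"
proof
  show "edom f \<subseteq> fst ` epi f"
  proof
    fix x assume "x \<in> edom f"
    then obtain r where "f x < ereal r"
      using less_PInf_Ex_of_nat[of "f x"] unfolding edom_def by auto
    then have "(x, r) \<in> epi f" by (simp add: epi_def)
    then show "x \<in> fst ` epi f" by force
  qed
qed (auto simp: edom_def epi_def)

lemma closure_fun_le: "closure_fun f x \<le> f x"
proof (rule ereal_le_real)
  fix r assume "f x \<le> ereal r"
  then have "(x, r) \<in> closure (epi f)"
    by (intro subsetD[OF closure_subset]) (simp add: epi_def)
  then show "closure_fun f x \<le> ereal r"
    unfolding closure_fun_def by (intro Inf_lower) simp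
qed

lemma closure_fun_ge_of_lower_bound:
  fixes f :: "'a::euclidean_space \<Rightarrow> ereal"
  assumes f: "nearly_convex_fun f" and D: "nearly_convex D"
    and ri: "rel_interior D \<inter> rel_interior (edom f) \<noteq> {}"
    and m: "\<And>x. x \<in> D \<Longrightarrow> ereal m \<le> f x" and y: "y \<in> closure D"
  shows "ereal m \<le> closure_fun f y"
proof -
  obtain z where z: "z \<in> rel_interior D" "z \<in> rel_interior (edom f)"
    using ri by blast
  have epi: "nearly_convex (epi f)"
    using f by (simp add: nearly_convex_fun_def)
  have "rel_interior (edom f) = fst ` rel_interior (epi f)"
    unfolding edom_eq_fst_epi
    using nearly_convex_linear_image_rel_interior[OF linear_fst epi] .
  then obtain s where s: "(z, s) \<in> rel_interior (epi f)"
    using z(2) by auto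
  have "m \<le> r" if r: "(y, r) \<in> closure (epi f)" for r
  proof -
    \<comment> \<open>Shrinking \<open>y\<close> towards \<open>z\<close> and \<open>(y, r)\<close>
      towards \<open>(z, s)\<close> with the same \<open>t\<close> yields the same base point, which
      therefore lies in \<open>D\<close> and carries an epigraph point.\<close>
    have bound: "m \<le> r - t * (r - s)" if t: "0 < t" "t \<le> 1" for t
    proof -
      let ?w = "y - t *\<^sub>R (y - z)"
      have "?w \<in> D"
        using nearly_convex_segment_in_rel_interior[OF D z(1) y t] rel_interior_subset by blast
      moreover have "(?w, r - t * (r - s)) \<in> epi f"
        using nearly_convex_segment_in_rel_interior[OF epi s r t] rel_interior_subset by auto
      ultimately show ?thesis
        using m[of ?w] by (auto simp: epi_def dest: order_trans)
    qed
    \<comment> \<open>Since \<open>t = 0\<close> is excluded from the bound,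
      \<open>m \<le> r\<close> is obtained as a limit from the right.\<close>
    have "((\<lambda>t. r - t * (r - s)) \<longlongrightarrow> r - 0 * (r - s)) (at_right 0)"
      by (intro tendsto_intros)
    moreover have "\<forall>\<^sub>F t in at_right 0. m \<le> r - t * (r - s)"
      unfolding eventually_at_right_field using bound by (intro exI[of _ 1]) auto
    ultimately show "m \<le> r"
      by (auto intro: tendsto_lowerbound)
  qed
  then show ?thesis
    unfolding closure_fun_def by (intro Inf_greatest) auto
qed

theorem corollary3p1:
  fixes f :: "real ^ 'n \<Rightarrow> ereal" and D :: "(real ^ 'n) set"
  assumes "proper_fun f"
    and "nearly_convex_fun f"
    and "D \<noteq> {}"
    and "nearly_convex D"
    and "rel_interior D \<inter> rel_interior (edom f) \<noteq> {}"
  shows "solution_set f D \<subseteq> solution_set (closure_fun f) (closure D)"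
proof
  fix x assume "x \<in> solution_set f D"
  then have x: "x \<in> D" and min: "\<And>y. y \<in> D \<Longrightarrow> f x \<le> f y"
    by (auto simp: solution_set_def)
  \<comment> \<open>A feasible point of finite value bounds the minimum above; with properness the
    minimum is a real \<open>m\<close>.\<close>
  obtain z where "z \<in> D" "z \<in> edom f"
    using assms(5) rel_interior_subset by blast
  then have "f x < \<infinity>"
    using min[of z] by (auto simp: edom_def)
  moreover have "f x > -\<infinity>"
    using assms(1) by (simp add: proper_fun_def)
  ultimately obtain m where m: "f x = ereal m"
    by (cases "f x") auto
  \<comment> \<open>The chain is
    \<open>closure_fun f x \<le> f x = m \<le> closure_fun f y\<close>.\<close>
  have "closure_fun f x \<le> closure_fun f y" if "y \<in> closure D" for y
    using closure_fun_ge_of_lower_bound[OF assms(2,4,5) _ that, of m] min m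
      closure_fun_le[of f x] by (auto intro: order_trans)
  then show "x \<in> solution_set (closure_fun f) (closure D)"
    using x closure_subset by (auto simp: solution_set_def)
qed

end
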